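(* Let $n\ge1$ be an integer, $\sigma^2>0$, and $\mu\in\mathbb{H}^n$, where $\mathbb{H}^n$ is $n$-dimensional hyperbolic space of constant sectional curvature $-1$. For $R\ge0$ and integer $m\ge0$ let $$H_{m,\sigma^2}(R):=\frac1{2^m}\sqrt{\frac{\pi\sigma^2}{2}}\sum_{j=0}^m\binom mj(-1)^j\exp\Big(\frac{(m-2j)^2\sigma^2}{2}\Big)\,\mathrm{erf}\Big(\frac{R}{\sqrt{2\sigma^2}}-\sqrt{\frac{\sigma^2}{2}}\,(m-2j)\Big).$$ (a) The normalizing constant of the Riemannian normal distribution on $\mathbb{H}^n$ is $$C_{\mathbb{H}^n}(\mu,\sigma^2):=\int_{\mathbb{H}^n}\exp\Big(-\frac{d(y,\mu)^2}{2\sigma^2}\Big)dy=\frac{2\pi^{n/2}}{\Gamma(\frac n2)}\Big(\lim_{R'\to\infty}H_{n-1,\sigma^2}(R')-H_{n-1,\sigma^2}(0)\Big),$$ where $$\lim_{R\to\infty}H_{n-1,\sigma^2}(R)=\frac{1}{2^{n-1}}\sqrt{\frac{\pi\sigma^2}{2}}\sum_{j=0}^{n-1}\binom{n-1}{j}(-1)^j\exp\Big(\frac{(n-1-2j)^2\sigma^2}{2}\Big),$$ and so the Riemannian normal density on $\mathbb{H}^n$ is $f(y;\mu,\sigma^2)=\exp\big(-d(y,\mu)^2/(2\sigma^2)\big)/C_{\mathbb{H}^n}(\mu,\sigma^2)$ with this value of $C_{\mathbb{H}^n}(\mu,\sigma^2)$. (b) If $y$ is a random point of $\mathbb{H}^n$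 with density $f(\cdot;\mu,\sigma^2)$, then the distribution function of $d(y,\mu)$ is $$F_{\mathbb{H}^n}(R):=\Pr(d(y,\mu)\le R)=\begin{cases}0&\text{if }R<0,\\[2pt] \dfrac{H_{n-1,\sigma^2}(R)-H_{n-1,\sigma^2}(0)}{\lim_{R'\to\infty}H_{n-1,\sigma^2}(R')-H_{n-1,\sigma^2}(0)}&\text{if }R\ge0.\end{cases}$$
   Context: $d$ is the geodesic distance on $\mathbb{H}^n$ and $dy$ its Riemannian volume measure. Concretely (hyperboloid model), with the Minkowski form $\langle p,q\rangle_{\mathbf M}=-p^1q^1+\sum_{j=2}^{n+1}p^jq^j$ on $\mathbb{R}^{n+1}$, $\mathbb{H}^n=\{p\in\mathbb{R}^{n+1}:\langle p,p\rangle_{\mathbf M}=-1,\ p^1>0\}$ with the Riemannian metric induced by $\langle\cdot,\cdot\rangle_{\mathbf M}$ on tangent spaces, and $d(p_1,p_2)=\cosh^{-1}(-\langle p_1,p_2\rangle_{\mathbf M})$. The Riemannian normal distribution on a connected Riemannian manifold $M$ with parameters $\mu\in M$, $\sigma^2>0$ has density $f(y;\mu,\sigma^2)=\frac{1}{C_M(\mu,\sigma^2)}\exp\big(-\frac{d(y,\mu)^2}{2\sigma^2}\big)$ with respect to the Riemannian volume measure, where $C_M(\mu,\sigma^2)=\int_M\exp\big(-\frac{d(y,\mu)^2}{2\sigma^2}\big)dy$ (assumed finite). $\mathrm{erf}(z)=\frac{2}{\sqrt\pi}\int_0^ze^{-t^2}dt$ is the error function. *)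

theory Defs
  imports "HOL-Probability.Probability"
begin

text \<open>
  Points of the ambient Minkowski space of dimension \<open>n + 1\<close>, \<open>n = CARD('n)\<close>, are pairs
  \<open>(t, x)\<close>: \<open>t\<close> is the first (timelike) coordinate and \<open>x\<close> collects the other \<open>n\<close> coordinates.
\<close>

definition minkowski :: "real \<times> (real ^ 'n) \<Rightarrow> real \<times> (real ^ 'n) \<Rightarrow> real" where
  "minkowski p q = - (fst p * fst q) + (\<Sum>j\<in>UNIV. snd p $ j * snd q $ j)"

definition hyperbolic_space :: "(real \<times> (real ^ 'n)) set" where
  "hyperbolic_space = {p. minkowski p p = -1 \<and> fst p > 0}"

definition hyp_dist :: "real \<times> (real ^ 'n) \<Rightarrow> real \<times> (real ^ 'n) \<Rightarrow> real" where
  "hyp_dist p q = arcosh (- minkowski p q)"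

text \<open>
  The upper sheet of the hyperboloid is the graph of \<open>x \<mapsto> sqrt (1 + \<bar>x\<bar>\<^sup>2)\<close>, so one global
  parametrization by \<open>real ^ 'n\<close> covers it.
\<close>

definition hyp_param :: "real ^ 'n \<Rightarrow> real \<times> (real ^ 'n)" where
  "hyp_param x = (sqrt (1 + (norm x)\<^sup>2), x)"

text \<open>
  The matrix \<open>(g\<^sub>i\<^sub>j)\<close> of the Riemannian metric in these coordinates: the Minkowski form
  evaluated on the coordinate tangent vectors.
\<close>

definition hyp_metric :: "real ^ 'n \<Rightarrow> real ^ 'n ^ 'n" where
  "hyp_metric x = (\<chi> i j.
     minkowski (frechet_derivative hyp_param (at x) (axis i 1))
               (frechet_derivative hyp_param (at x) (axis j 1)))"

text \<open>
  The Riemannian volume measure is \<open>sqrt (det g) dx\<close> in coordinates, transported to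
  hyperbolic space. It does not depend on the parametrization, by the change of variables
  formula.
\<close>

definition hyp_volume :: "(real \<times> (real ^ 'n)) measure" where
  "hyp_volume =
     distr (density lborel (\<lambda>x. ennreal (sqrt (det (hyp_metric x)))))
           (restrict_space borel hyperbolic_space) hyp_param"

definition riem_normal_const :: "'a measure \<Rightarrow> ('a \<Rightarrow> 'a \<Rightarrow> real) \<Rightarrow> 'a \<Rightarrow> real \<Rightarrow> real" where
  "riem_normal_const vol d \<mu> \<sigma>2 = (\<integral>y. exp (- (d y \<mu>)\<^sup>2 / (2 * \<sigma>2)) \<partial>vol)"

definition riem_normal_density ::
    "'a measure \<Rightarrow> ('a \<Rightarrow> 'a \<Rightarrow> real) \<Rightarrow> 'a \<Rightarrow> real \<Rightarrow> 'a \<Rightarrow> real" where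
  "riem_normal_density vol d \<mu> \<sigma>2 y =
     1 / riem_normal_const vol d \<mu> \<sigma>2 * exp (- (d y \<mu>)\<^sup>2 / (2 * \<sigma>2))"

text \<open>The interval integral is oriented, so this is the usual odd function also for \<open>z < 0\<close>.\<close>

definition erf :: "real \<Rightarrow> real" where
  "erf z = 2 / sqrt pi * (LBINT t=ereal 0..ereal z. exp (- t\<^sup>2))"

definition H_fun :: "nat \<Rightarrow> real \<Rightarrow> real \<Rightarrow> real" where
  "H_fun m \<sigma>2 R = 1 / 2 ^ m * sqrt (pi * \<sigma>2 / 2) *
     (\<Sum>j=0..m. real (m choose j) * (-1) ^ j * exp ((real m - 2 * real j)\<^sup>2 * \<sigma>2 / 2) *
        erf (R / sqrt (2 * \<sigma>2) - sqrt (\<sigma>2 / 2) * (real m - 2 * real j)))"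

text \<open>The parametrization is a smooth bijection onto hyperbolic space, measurable as used above.\<close>

lemma norm_sq_vec: "(norm (x :: real ^ 'n))\<^sup>2 = (\<Sum>j\<in>UNIV. x $ j * x $ j)"
  by (simp add: power2_norm_eq_inner inner_vec_def)

lemma bij_betw_hyp_param:
  "bij_betw hyp_param UNIV (hyperbolic_space :: (real \<times> (real ^ 'n)) set)"
proof (rule bij_betwI[where g = snd])
  show "hyp_param \<in> UNIV \<rightarrow> (hyperbolic_space :: (real \<times> (real ^ 'n)) set)"
  proof
    fix x :: "real ^ 'n"
    have "1 + (norm x)\<^sup>2 > 0" by (simp add: add_pos_nonneg)
    then show "hyp_param x \<in> hyperbolic_space"
      by (simp add: hyp_param_def hyperbolic_space_def minkowski_def
          flip: norm_sq_vec)
  qed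
next
  fix p :: "real \<times> (real ^ 'n)" assume "p \<in> hyperbolic_space"
  then have "fst p * fst p = 1 + (norm (snd p))\<^sup>2" and pos: "fst p > 0"
    unfolding norm_sq_vec by (simp_all add: hyperbolic_space_def minkowski_def)
  then have "sqrt (1 + (norm (snd p))\<^sup>2) = fst p"
    by (metis abs_of_pos real_sqrt_abs2)
  then show "hyp_param (snd p) = p" by (simp add: hyp_param_def)
qed (simp_all add: hyp_param_def)

lemma hyp_param_differentiable:
  fixes x :: "real ^ 'n"
  shows "hyp_param differentiable (at x)"
proof -
  have "1 + x \<bullet> x > 0" by (simp add: add_pos_nonneg)
  then have "sqrt differentiable (at (1 + x \<bullet> x))"
    using DERIV_real_sqrt real_differentiable_def by blast
  then have "(sqrt \<circ> (\<lambda>x. 1 + x \<bullet> x)) differentiable (at x)"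
    by (intro differentiable_chain_at) (simp_all add: differentiable_inner)
  then obtain D where D: "((\<lambda>x. sqrt (1 + (norm x)\<^sup>2)) has_derivative D) (at x)"
    by (auto simp: differentiable_def o_def power2_norm_eq_inner)
  have "hyp_param = (\<lambda>x :: real ^ 'n. (sqrt (1 + (norm x)\<^sup>2), x))"
    by (rule ext) (rule hyp_param_def)
  with has_derivative_Pair[OF D has_derivative_ident] show ?thesis
    unfolding differentiable_def by metis
qed

lemma measurable_hyp_param:
  "hyp_param \<in> borel \<rightarrow>\<^sub>M restrict_space borel (hyperbolic_space :: (real \<times> (real ^ 'n)) set)"
proof (rule measurable_restrict_space2)
  show "hyp_param \<in> space borel \<rightarrow> (hyperbolic_space :: (real \<times> (real ^ 'n)) set)"
    using bij_betw_hyp_param by (auto simp: bij_betw_def)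
  show "hyp_param \<in> borel \<rightarrow>\<^sub>M (borel :: (real \<times> (real ^ 'n)) measure)"
    unfolding hyp_param_def by (intro borel_measurable_continuous_onI continuous_intros)
qed

end

theory Submission
  imports Defs
begin

text \<open>
  A Lorentz boost moves \<open>\<mu>\<close> to the vertex of the hyperboloid. In the coordinates \<open>x\<close> it is a
  rank-one perturbation of the identity with Jacobian \<open>t' / t\<close>, where \<open>t\<close> and \<open>t'\<close> are the
  timelike coordinates before and after the boost, so it preserves the volume measure
  \<open>dx / t\<close>, and balls around \<open>\<mu>\<close> have the same volume as balls around the vertex. The
  substitution \<open>\<bar>x\<bar> = sinh r\<close> in the volume of Euclidean balls then gives the distance
  to \<open>\<mu>\<close> the density \<open>n \<omega>\<^sub>n sinh\<^sup>n\<^sup>-\<^sup>1 r\<close>, where \<open>\<omega>\<^sub>n\<close> is the volume of the unit ball.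
  Expanding \<open>sinh\<^sup>m r\<close> binomially and completing squares shows that \<open>H\<^sub>m\<close> is an
  antiderivative of \<open>sinh\<^sup>m r exp (- r\<^sup>2 / (2 \<sigma>\<^sup>2))\<close>.
\<close>

subsection \<open>Volume form of the hyperboloid\<close>

lemma det_identity_row:
  fixes v :: "'a::field ^ 'n"
  shows "det (\<chi> i. if i = k then v else axis i 1) = v $ k"
proof -
  have row: "row i (mat 1 :: 'a^'n^'n) = axis i 1" for i
    by (simp add: row_def mat_def axis_def vec_eq_iff)
  \<comment> \<open>Cramer's rule for the identity matrix: \<open>v\<close> is the combination of
    its rows with coefficients \<open>v $ i\<close>.\<close>
  show ?thesis
    using cramer_lemma_transpose[of k v "mat 1"] unfolding row basis_expansion by simp
qed

text \<open>The rows in \<open>S\<close> differ from standard rows by multiples of row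
  \<open>k\<close>. Such row operations leave the determinant unchanged, so induction on
  \<open>S\<close> reduces to \<open>det_identity_row\<close>.\<close>

lemma det_row_plus_multiples:
  fixes u v :: "'a::field ^ 'n"
  assumes "finite S" "k \<notin> S"
  shows "det (\<chi> i. if i = k then v else if i \<in> S then axis i 1 + u $ i *s v else axis i 1) = v $ k"
  using assms
proof (induction S)
  case empty
  then show ?case by (simp add: det_identity_row cong: if_cong)
next
  case (insert j S)
  let ?A = "(\<chi> i. if i = k then v else if i \<in> S then axis i 1 + u $ i *s v else axis i 1) :: 'a^'n^'n"
  have jk: "j \<noteq> k" using insert by auto
  have row: "row i ?A = ?A $ i" for i by (simp add: row_def vec_eq_iff)
  have "(\<chi> i. if i = k then v else if i \<in> insert j S then axis i 1 + u $ i *s v else axis i 1)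
      = (\<chi> i. if i = j then row j ?A + u $ j *s row k ?A else row i ?A)"
    unfolding row using insert.hyps jk by (auto simp: vec_eq_iff)
  then show ?case
    using det_row_operation[OF jk, of ?A "u $ j"] insert by simp
qed

text \<open>The standard rows are replaced one at a time. The determinant is additive in row
  \<open>k\<close>: the standard part reproduces the previous matrix, and the part
  \<open>u $ k *s v\<close> contributes \<open>u $ k * v $ k\<close>, because it can clear the
  multiples of \<open>v\<close> from all other rows.\<close>

lemma det_identity_plus_rank_one:
  fixes u v :: "'a::field ^ 'n"
  shows "det (\<chi> i j. (if i = j then 1 else 0) + u $ i * v $ j) = 1 + (\<Sum>i\<in>UNIV. u $ i * v $ i)"
proof -
  have "det (\<chi> i. if i \<in> S then axis i 1 + u $ i *s v else axis i 1) = 1 + (\<Sum>i\<in>S. u $ i * v $ i)"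
    if "finite S" for S
    using that
  proof (induction S)
    case empty
    have "(\<chi> i. axis i 1) = (mat 1 :: 'a^'n^'n)"
      by (simp add: mat_def axis_def vec_eq_iff)
    then show ?case by (simp add: det_I)
  next
    case (insert k S)
    let ?c = "\<lambda>i. if i \<in> S then axis i 1 + u $ i *s v else axis i 1"
    have *: "(\<chi> i. if i \<in> insert k S then axis i 1 + u $ i *s v else axis i 1)
        = (\<chi> i. if i = k then axis k 1 + u $ k *s v else ?c i)"
      by (auto simp: vec_eq_iff)
    have "det (\<chi> i. if i = k then axis k 1 + u $ k *s v else ?c i) = det (\<chi> i. if i = k then axis k 1 else ?c i)
        + det (\<chi> i. if i = k then u $ k *s v else ?c i)"
      by (rule det_row_add[where a = "\<lambda>i. axis k 1" and b = "\<lambda>i. u $ k *s v"])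
    also have "det (\<chi> i. if i = k then u $ k *s v else ?c i) = u $ k * v $ k"
      using det_row_mul[of k "u $ k" "\<lambda>i. v" ?c] det_row_plus_multiples[OF insert.hyps, of v u]
      by simp
    also have "(\<chi> i. if i = k then axis k 1 else ?c i) = (\<chi> i. ?c i)"
      using insert.hyps by (auto simp: vec_eq_iff)
    finally show ?case
      unfolding * using insert by (simp add: add_ac)
  qed
  from this[of UNIV] have "det (\<chi> i. axis i 1 + u $ i *s v) = 1 + (\<Sum>i\<in>UNIV. u $ i * v $ i)"
    by simp
  moreover have "(\<chi> i. axis i 1 + u $ i *s v) = (\<chi> i j. (if i = j then 1 else 0) + u $ i * v $ j)"
    by (auto simp: vec_eq_iff axis_def)
  ultimately show ?thesis by simp
qed

section \<open>Metric tensor and volume density in the graph coordinates\<close>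

lemma one_plus_norm_sq_pos [simp]: "0 < 1 + (norm x)\<^sup>2"
  by (simp add: add_pos_nonneg)

lemma has_derivative_sqrt_one_plus_norm_sq [derivative_intros]:
  fixes x :: "'a::real_inner"
  shows "((\<lambda>x. sqrt (1 + (norm x)\<^sup>2)) has_derivative (\<lambda>h. (x \<bullet> h) / sqrt (1 + (norm x)\<^sup>2))) (at x within S)"
proof -
  have pos: "0 < 1 + x \<bullet> x" by (simp add: add_pos_nonneg)
  have "((\<lambda>x. 1 + x \<bullet> x) has_derivative (\<lambda>h. 0 + (x \<bullet> h + h \<bullet> x))) (at x within S)"
    by (intro derivative_intros)
  from has_derivative_real_sqrt[where g = "\<lambda>x. 1 + x \<bullet> x", OF pos this]
  have "((\<lambda>x. sqrt (1 + x \<bullet> x)) has_derivative (\<lambda>h. (x \<bullet> h) / sqrt (1 + x \<bullet> x))) (at x within S)"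
    by (simp add: inner_commute field_simps)
  then show ?thesis by (simp add: power2_norm_eq_inner)
qed

lemma frechet_derivative_hyp_param:
  fixes x :: "real ^ 'n"
  shows "frechet_derivative hyp_param (at x) h = ((x \<bullet> h) / sqrt (1 + (norm x)\<^sup>2), h)"
proof -
  have "(hyp_param has_derivative (\<lambda>h. ((x \<bullet> h) / sqrt (1 + (norm x)\<^sup>2), h))) (at x)"
    unfolding hyp_param_def[abs_def] by (auto intro!: derivative_eq_intros)
  from fun_cong[OF frechet_derivative_at[OF this], of h] show ?thesis by simp
qed

text \<open>The coordinate tangent vectors have timelike parts \<open>x $ i / t\<close>, which enter
  the Minkowski form with a minus sign. The matrix is written as a rank-one perturbation of the
  identity so that its determinant can be read off.\<close>

lemma hyp_metric_eq:
  fixes x :: "real ^ 'n"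
  shows "hyp_metric x = (\<chi> i j. (if i = j then 1 else 0) + (- x $ i / (1 + (norm x)\<^sup>2)) * x $ j)"
proof -
  define t where "t = sqrt (1 + (norm x)\<^sup>2)"
  have t: "t * t = 1 + (norm x)\<^sup>2" by (simp add: t_def)
  have "hyp_metric x $ i $ j = (if i = j then 1 else 0) + (- x $ i / (1 + (norm x)\<^sup>2)) * x $ j" for i j
  proof -
    have "(\<Sum>k\<in>UNIV. axis i 1 $ k * axis j 1 $ k) = axis i (1::real) \<bullet> axis j 1"
      by (simp add: inner_vec_def)
    also have "\<dots> = (if i = j then 1 else 0)"
      by (simp add: inner_axis_axis)
    finally have "hyp_metric x $ i $ j = (if i = j then 1 else 0) - (x $ i / t) * (x $ j / t)"
      by (simp add: hyp_metric_def minkowski_def frechet_derivative_hyp_param inner_axis flip: t_def)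
    then show ?thesis by (simp flip: t)
  qed
  then show ?thesis by (simp add: vec_eq_iff)
qed

lemma det_hyp_metric:
  fixes x :: "real ^ 'n"
  shows "det (hyp_metric x) = 1 / (1 + (norm x)\<^sup>2)"
proof -
  let ?u = "\<chi> i. - x $ i / (1 + (norm x)\<^sup>2)"
  have "det (hyp_metric x) = 1 + (\<Sum>i\<in>UNIV. ?u $ i * x $ i)"
    unfolding hyp_metric_eq using det_identity_plus_rank_one[of ?u x] by simp
  also have "(\<Sum>i\<in>UNIV. ?u $ i * x $ i) = - (norm x)\<^sup>2 / (1 + (norm x)\<^sup>2)"
    unfolding norm_sq_vec by (simp add: sum_negf sum_divide_distrib)
  also have "1 + \<dots> = 1 / (1 + (norm x)\<^sup>2)"
    using less_imp_neq[OF one_plus_norm_sq_pos[of x]] by (simp add: field_simps)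
  finally show ?thesis .
qed

subsection \<open>Euclidean space over a well-ordered index type\<close>

text \<open>
  The change of variables theorem of the library is restricted to \<open>real ^ 'm\<close> with a
  well-ordered \<open>'m\<close>. A copy of the finite type \<open>'n\<close> that carries some well-order makes
  it available for \<open>real ^ 'n\<close>.
\<close>

typedef 'n wo = "UNIV :: 'n set" by auto

instance wo :: (finite) finite
proof
  have "(UNIV :: 'a wo set) = range Abs_wo"
    using Rep_wo_inverse by (metis UNIV_eq_I rangeI)
  then show "finite (UNIV :: 'a wo set)" by (metis finite finite_imageI)
qed

text \<open>Any injection into the natural numbers serves. Pulling the order back along it reduces
  well-foundedness to induction on a natural number.\<close>

definition wo_index :: "'n::finite wo \<Rightarrow> nat" where
  "wo_index = (SOME f. inj f)"

lemma inj_wo_index: "inj wo_index"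
proof -
  have "\<exists>f :: 'a wo \<Rightarrow> nat. inj f"
    using finite_imp_inj_to_nat_seg[of "UNIV :: 'a wo set"] by auto
  then show ?thesis unfolding wo_index_def by (rule someI_ex)
qed

instantiation wo :: (finite) wellorder
begin

definition less_eq_wo :: "'a wo \<Rightarrow> 'a wo \<Rightarrow> bool" where
  "less_eq_wo x y \<longleftrightarrow> wo_index x \<le> wo_index y"

definition less_wo :: "'a wo \<Rightarrow> 'a wo \<Rightarrow> bool" where
  "less_wo x y \<longleftrightarrow> wo_index x < wo_index y"

instance
proof
  fix P :: "'a wo \<Rightarrow> bool" and a
  assume "\<And>x. (\<And>y. y < x \<Longrightarrow> P y) \<Longrightarrow> P x"
  then show "P a"
    unfolding less_wo_def by (induction a rule: measure_induct_rule[of wo_index]) blast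
qed (auto simp: less_eq_wo_def less_wo_def dest: injD[OF inj_wo_index])

end

definition wo_vec :: "real ^ 'n::finite \<Rightarrow> real ^ 'n wo" where
  "wo_vec x = (\<chi> i. x $ Rep_wo i)"

lemma bij_Rep_wo: "bij Rep_wo"
  by (metis Rep_wo_inverse Abs_wo_inverse UNIV_I bijI')

lemma inner_wo_vec [simp]: "wo_vec x \<bullet> wo_vec y = x \<bullet> y"
  unfolding wo_vec_def inner_vec_def
  by (simp add: sum.reindex_bij_betw[OF bij_Rep_wo, where g = "\<lambda>i. x $ i * y $ i"])

lemma norm_wo_vec [simp]: "norm (wo_vec x) = norm x"
  by (simp add: norm_eq_sqrt_inner)

lemma wo_vec_measurable [measurable]: "wo_vec \<in> borel_measurable borel"
  unfolding wo_vec_def[abs_def] by (intro borel_measurable_continuous_onI continuous_intros)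

lemma prod_Basis_vec: "(\<Prod>b\<in>(Basis :: (real ^ 'n) set). x \<bullet> b) = (\<Prod>i\<in>UNIV. x $ i)"
proof (rule prod.reindex_cong[where l = "\<lambda>i. axis i 1"])
  show "inj (\<lambda>i :: 'n. axis i (1 :: real))" by (auto simp: inj_on_def axis_eq_axis)
  show "(Basis :: (real ^ 'n) set) = range (\<lambda>i. axis i 1)" by (auto simp: Basis_vec_def)
qed (simp add: inner_axis)

text \<open>Lebesgue measure is determined by its values on boxes, and relabelling the coordinates
  turns a box into a box with the same side lengths.\<close>

lemma distr_lborel_wo_vec: "distr lborel borel (wo_vec :: real ^ 'n \<Rightarrow> _) = lborel"
proof (rule lborel_eqI[symmetric])
  fix l u :: "real ^ 'n wo"
  assume le: "\<And>b. b \<in> Basis \<Longrightarrow> l \<bullet> b \<le> u \<bullet> b"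
  define l' u' :: "real ^ 'n" where "l' = (\<chi> i. l $ Abs_wo i)" and "u' = (\<chi> i. u $ Abs_wo i)"
  have bij: "bij (Abs_wo :: 'n \<Rightarrow> 'n wo)"
    by (metis Rep_wo_inverse Abs_wo_inverse UNIV_I bijI')
  have le': "l $ i \<le> u $ i" for i
    using le[of "axis i 1"] by (simp add: inner_axis axis_in_Basis_iff)
  have "l' \<bullet> b \<le> u' \<bullet> b" if "b \<in> Basis" for b
    using that le' by (auto simp: Basis_vec_def inner_axis l'_def u'_def)
  from emeasure_lborel_box[of l' u', OF this] have box: "emeasure lborel (box l' u') = ennreal (\<Prod>i\<in>UNIV. (u' - l') $ i)"
    by (simp only: prod_Basis_vec)
  have vimage: "wo_vec -` box l u = box l' u'"
    by (auto simp: wo_vec_def mem_box_cart l'_def u'_def; metis Rep_wo_inverse Abs_wo_inverse UNIV_I)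
  have "emeasure (distr lborel borel wo_vec) (box l u) = emeasure lborel (box l' u')"
    by (subst emeasure_distr) (auto simp: vimage)
  also have "\<dots> = ennreal (\<Prod>i\<in>UNIV. (u' - l') $ i)"
    using box by simp
  also have "(\<Prod>i\<in>UNIV. (u' - l') $ i) = (\<Prod>i\<in>UNIV. (u - l) $ i)"
    using prod.reindex_bij_betw[OF bij, of "\<lambda>i. (u - l) $ i"] by (simp add: l'_def u'_def)
  also have "\<dots> = (\<Prod>b\<in>Basis. (u - l) \<bullet> b)"
    by (rule prod_Basis_vec[symmetric])
  finally show "emeasure (distr lborel borel wo_vec) (box l u) = (\<Prod>b\<in>Basis. (u - l) \<bullet> b)" .
qed simp

subsection \<open>Lorentz boosts\<close>

text \<open>The timelike coordinate of the point of the hyperboloid above \<open>x\<close>.\<close>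

definition height :: "'a::real_inner \<Rightarrow> real" where
  "height x = sqrt (1 + (norm x)\<^sup>2)"

lemma height_sq: "(height x)\<^sup>2 = 1 + (norm x)\<^sup>2"
  by (simp add: height_def)

lemma height_pos [simp]: "0 < height x"
  by (simp add: height_def)

lemma height_ge_1 [simp]: "1 \<le> height x"
  by (simp add: height_def)

lemma height_minus [simp]: "height (- x) = height x"
  by (simp add: height_def)

lemma norm_le_height: "norm x \<le> height x"
  unfolding height_def by (rule real_le_rsqrt) simp

lemma height_measurable [measurable]:
  "height \<in> borel_measurable (borel :: 'a::euclidean_space measure)"
  unfolding height_def[abs_def] by measurable

lemma has_derivative_height [derivative_intros]:
  "(height has_derivative (\<lambda>h. (x \<bullet> h) / height x)) (at x within S)"
  unfolding height_def[abs_def] by (rule has_derivative_sqrt_one_plus_norm_sq)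

lemma inner_less_height_mult: "a \<bullet> x < height a * height x"
proof -
  have "(norm a * norm x)\<^sup>2 < (height a * height x)\<^sup>2"
    unfolding power_mult_distrib height_sq by (simp add: algebra_simps add_pos_nonneg)
  then have "norm a * norm x < height a * height x"
    by (rule power2_less_imp_less) (simp add: less_imp_le)
  then show ?thesis
    using norm_cauchy_schwarz[of a x] by linarith
qed

text \<open>Reversed Cauchy-Schwarz inequality for the Minkowski form: the squares of
  \<open>height a * height x\<close> and \<open>1 + norm a * norm x\<close> differ by
  \<open>(norm a - norm x)^2\<close>. It places the argument of \<open>arcosh\<close> in the
  distance in \<open>[1, infinity)\<close>.\<close>

lemma height_mult_minus_inner_ge_1: "1 \<le> height a * height x - a \<bullet> x"
proof -
  have "0 \<le> (norm a - norm x)\<^sup>2" by simp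
  then have "(1 + norm a * norm x)\<^sup>2 \<le> (height a * height x)\<^sup>2"
    unfolding power_mult_distrib height_sq by (simp add: power2_eq_square algebra_simps)
  then have "1 + norm a * norm x \<le> height a * height x"
    by (rule power2_le_imp_le) (simp add: less_imp_le)
  then show ?thesis
    using norm_cauchy_schwarz[of a x] by linarith
qed

text \<open>
  The Lorentz boost that moves the point of the hyperboloid above \<open>a\<close> to the vertex,
  read off on the spacelike coordinates.
\<close>

definition boost :: "'a::real_inner \<Rightarrow> 'a \<Rightarrow> 'a" where
  "boost a x = x + ((a \<bullet> x) / (1 + height a) - height x) *\<^sub>R a"

text \<open>The right side is minus the Minkowski product of the points above \<open>a\<close> and
  \<open>x\<close>. Since the boost sends the point above \<open>a\<close> to the vertex and
  preserves that form, this product becomes the new timelike coordinate. The computation clears the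
  denominator in \<open>k\<close>, which leaves a polynomial identity.\<close>

lemma height_boost: "height (boost a x) = height a * height x - a \<bullet> x"
proof -
  define k where "k = (a \<bullet> x) / (1 + height a) - height x"
  have "1 + height a \<noteq> 0" using height_pos[of a] by linarith
  then have k: "(1 + height a) * k = a \<bullet> x - height x * (1 + height a)"
    by (simp add: k_def field_simps)
  have a: "(norm a)\<^sup>2 = (height a)\<^sup>2 - 1" and x: "(norm x)\<^sup>2 = (height x)\<^sup>2 - 1"
    by (simp_all add: height_sq)
  have "(norm (boost a x))\<^sup>2 = (norm x)\<^sup>2 + 2 * k * (a \<bullet> x) + k\<^sup>2 * (norm a)\<^sup>2"
    unfolding boost_def k_def[symmetric] power2_norm_eq_inner
    by (simp add: inner_add_left inner_add_right inner_commute power2_eq_square algebra_simps)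
  also have "\<dots> = (height a * height x - a \<bullet> x)\<^sup>2 - 1"
    unfolding a x using k by algebra
  finally have "height (boost a x) = sqrt ((height a * height x - a \<bullet> x)\<^sup>2)"
    by (simp add: height_def[of "boost a x"])
  then show ?thesis
    using inner_less_height_mult[of a x] by simp
qed

text \<open>Both boosts shift along \<open>a\<close>, so their composition adds a multiple of
  \<open>a\<close> to \<open>x\<close>. Multiplied by \<open>1 + height a\<close>, its coefficient
  becomes a polynomial that vanishes.\<close>

lemma boost_minus_boost: "boost (- a) (boost a x) = x"
proof -
  define k where "k = (a \<bullet> x) / (1 + height a) - height x"
  have nz: "1 + height a \<noteq> 0" using height_pos[of a] by linarith
  then have k: "(1 + height a) * k = a \<bullet> x - height x * (1 + height a)"
    by (simp add: k_def field_simps)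
  have a: "a \<bullet> a = (height a)\<^sup>2 - 1"
    by (simp add: height_sq power2_norm_eq_inner)
  have b: "boost a x = x + k *\<^sub>R a"
    by (simp add: boost_def k_def)
  have "(1 + height a) * (k + w / (1 + height a) + z) = (1 + height a) * k + w + (1 + height a) * z" for w z
    by (simp add: distrib_left nz)
  then have "(1 + height a) * (k + (a \<bullet> (x + k *\<^sub>R a)) / (1 + height a) + (height a * height x - a \<bullet> x))
      = (1 + height a) * k + (a \<bullet> x + k * ((height a)\<^sup>2 - 1)) + (1 + height a) * (height a * height x - a \<bullet> x)"
    by (simp add: inner_add_right a)
  also have "\<dots> = 0"
    using k by algebra
  finally have "k + (a \<bullet> (x + k *\<^sub>R a)) / (1 + height a) + (height a * height x - a \<bullet> x) = 0"
    using nz by simp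
  moreover have "boost (- a) (boost a x)
      = x + (k + (a \<bullet> (x + k *\<^sub>R a)) / (1 + height a) + (height a * height x - a \<bullet> x)) *\<^sub>R a"
  proof -
    have "(x + k *\<^sub>R a) + ((- w) / d - z) *\<^sub>R (- a) = x + (k + w / d + z) *\<^sub>R a" for w d z
      by (simp add: algebra_simps)
    then show ?thesis
      unfolding boost_def[of "- a"] height_boost unfolding b by simp
  qed
  ultimately show ?thesis by simp
qed

lemma bij_boost: "bij (boost a)"
  using boost_minus_boost[of a] boost_minus_boost[of "- a"] by (intro bijI') (metis minus_minus)+

lemma boost_measurable [measurable]:
  "boost a \<in> borel_measurable (borel :: 'a::euclidean_space measure)"
  unfolding boost_def[abs_def] by measurable

lemma has_derivative_boost:
  "(boost a has_derivative (\<lambda>h. h + ((a \<bullet> h) / (1 + height a) - (x \<bullet> h) / height x) *\<^sub>R a)) (at x)"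
proof -
  have "((\<lambda>x. (a \<bullet> x) / (1 + height a)) has_derivative (\<lambda>h. (a \<bullet> h) / (1 + height a))) (at x)"
    by (intro bounded_linear.has_derivative[OF bounded_linear_divide] has_derivative_inner_right has_derivative_ident)
  then show ?thesis
    unfolding boost_def[abs_def]
    by (intro has_derivative_add has_derivative_ident has_derivative_scaleR_left
        has_derivative_diff has_derivative_height)
qed

text \<open>The derivative is the identity plus a rank-one matrix. The resulting ratio of heights is
  exactly the Jacobian that makes \<open>dx / height x\<close> invariant.\<close>

lemma det_boost:
  fixes a x :: "real ^ 'n"
  shows "det (matrix (\<lambda>h. h + ((a \<bullet> h) / (1 + height a) - (x \<bullet> h) / height x) *\<^sub>R a))
    = height (boost a x) / height x"
proof -
  let ?v = "\<chi> j. a $ j / (1 + height a) - x $ j / height x"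
  have nz: "1 + height a \<noteq> 0" "height x \<noteq> 0"
    using height_pos[of a] height_pos[of x] by linarith+
  have "matrix (\<lambda>h. h + ((a \<bullet> h) / (1 + height a) - (x \<bullet> h) / height x) *\<^sub>R a)
      = (\<chi> i j. (if i = j then 1 else 0) + a $ i * ?v $ j)"
    unfolding matrix_def by (simp add: vec_eq_iff inner_axis mult.commute) (auto simp: axis_def)
  then have "det (matrix (\<lambda>h. h + ((a \<bullet> h) / (1 + height a) - (x \<bullet> h) / height x) *\<^sub>R a))
      = 1 + (\<Sum>i\<in>UNIV. a $ i * ?v $ i)"
    by (simp only: det_identity_plus_rank_one)
  also have "(\<Sum>i\<in>UNIV. a $ i * ?v $ i) = (a \<bullet> a) / (1 + height a) - (a \<bullet> x) / height x"
    by (simp add: inner_vec_def right_diff_distrib sum_subtractf sum_divide_distrib)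
  \<comment> \<open>The square \<open>(height a)^2 - 1\<close> factors, and one factor cancels the
    denominator in the boost.\<close>
  also have "a \<bullet> a = (1 + height a) * (height a - 1)"
    by (simp add: height_sq power2_norm_eq_inner[symmetric] power2_eq_square[symmetric] algebra_simps)
  also have "1 + ((1 + height a) * (height a - 1) / (1 + height a) - (a \<bullet> x) / height x)
      = height (boost a x) / height x"
    using nz by (simp add: height_boost diff_divide_distrib)
  finally show ?thesis .
qed

section \<open>Change of variables and invariance of the volume under boosts\<close>

lemma nn_integral_change_of_variables:
  fixes T :: "real ^ 'm::{finite,wellorder} \<Rightarrow> real ^ 'm::_" and g :: "real ^ 'm::_ \<Rightarrow> real"
  assumes der: "\<And>x. (T has_derivative T' x) (at x)" and "bij T"
    and [measurable]: "T \<in> borel_measurable borel" "J \<in> borel_measurable borel" "g \<in> borel_measurable borel"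
    and J: "\<And>x. J x = \<bar>det (matrix (T' x))\<bar>" and g: "\<And>x. 0 \<le> g x"
    and fin: "(\<integral>\<^sup>+x. g x \<partial>lborel) < \<infinity>"
  shows "(\<integral>\<^sup>+x. J x * g (T x) \<partial>lborel) = (\<integral>\<^sup>+x. g x \<partial>lborel)"
proof -
  \<comment> \<open>Finiteness of the integral is what gives access to the theorem on absolutely
    integrable functions.\<close>
  have int: "integrable lborel g"
    using fin g by (intro integrableI_nonneg) auto
  then have "integrable lebesgue g"
    by (simp add: integrable_completion)
  then have abs: "g absolutely_integrable_on UNIV"
    by (simp add: set_integrable_def)
  have "inj T" and surj: "range T = UNIV"
    using \<open>bij T\<close> by (auto simp: bij_def)
  \<comment> \<open>That theorem concerns vector-valued integrands, so \<open>g\<close> is viewed as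
    a function into \<open>real ^ 1\<close>.\<close>
  from has_absolute_integral_change_of_variables[of UNIV T T' "\<lambda>x. vec (g x) :: real ^ 1"
      "vec (integral UNIV g)", OF _ has_derivative_at_withinI[OF der] \<open>inj T\<close>]
  have "(\<lambda>x. J x * g (T x)) absolutely_integrable_on UNIV \<and>
      integral UNIV (\<lambda>x. J x * g (T x)) = integral UNIV g"
    using abs unfolding J[symmetric] surj
    by (simp add: absolutely_integrable_on_1_iff integral_on_1_eq)
  then have abs': "(\<lambda>x. J x * g (T x)) absolutely_integrable_on UNIV"
    and eq: "integral UNIV (\<lambda>x. J x * g (T x)) = integral UNIV g" by auto
  have int': "integrable lborel (\<lambda>x. J x * g (T x))"
    using abs' by (simp add: set_integrable_def integrable_completion)
  have "(\<integral>\<^sup>+x. J x * g (T x) \<partial>lborel) = ennreal (\<integral>x. J x * g (T x) \<partial>lborel)"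
    using g J by (intro nn_integral_eq_integral int') auto
  also have "(\<integral>x. J x * g (T x) \<partial>lborel) = (\<integral>x. g x \<partial>lborel)"
    using eq set_lebesgue_integral_eq_integral(2)[OF abs] set_lebesgue_integral_eq_integral(2)[OF abs']
    by (simp add: set_lebesgue_integral_def integral_completion)
  also have "ennreal \<dots> = (\<integral>\<^sup>+x. g x \<partial>lborel)"
    using g by (intro nn_integral_eq_integral[symmetric] int) auto
  finally show ?thesis .
qed

text \<open>The hyperbolic volume read off on the spacelike coordinates, by
  \<open>det_hyp_metric\<close>.\<close>

definition chart_volume :: "(real ^ 'n) measure" where
  "chart_volume = density lborel (\<lambda>x. ennreal (1 / height x))"

lemma sets_chart_volume [measurable_cong, simp]: "sets chart_volume = sets borel"
  by (simp add: chart_volume_def)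

lemma space_chart_volume [simp]: "space chart_volume = UNIV"
  by (simp add: chart_volume_def)

lemma emeasure_chart_volume:
  "A \<in> sets borel \<Longrightarrow> emeasure chart_volume A = (\<integral>\<^sup>+x. ennreal (indicator A x / height x) \<partial>lborel)"
  unfolding chart_volume_def
  by (subst emeasure_density) (auto intro!: nn_integral_cong split: split_indicator)

lemma hyp_volume_eq: "hyp_volume = distr chart_volume (restrict_space borel hyperbolic_space) hyp_param"
  unfolding hyp_volume_def chart_volume_def det_hyp_metric
  by (simp add: height_def real_sqrt_divide)

text \<open>The density is at most 1 and the set lies in a Euclidean ball. This supplies the
  finiteness needed both for the change of variables and for identifying measures by their values on
  half-lines.\<close>

lemma emeasure_chart_volume_height_le_finite: "emeasure chart_volume {x :: real ^ 'n. height x \<le> c} < \<infinity>"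
proof -
  have "emeasure chart_volume {x :: real ^ 'n. height x \<le> c}
      = (\<integral>\<^sup>+x. ennreal (indicator {x. height x \<le> c} x / height x) \<partial>(lborel :: (real ^ 'n) measure))"
    by (rule emeasure_chart_volume) measurable
  also have "\<dots> \<le> (\<integral>\<^sup>+x. indicator (cball 0 c) x \<partial>(lborel :: (real ^ 'n) measure))"
  proof (rule nn_integral_mono)
    fix x :: "real ^ 'n"
    show "ennreal (indicator {x. height x \<le> c} x / height x) \<le> indicator (cball 0 c) x"
    proof (cases "height x \<le> c")
      case True
      then have "norm x \<le> c" using norm_le_height[of x] by linarith
      then show ?thesis using True by (simp add: ennreal_le_1)
    qed simp
  qed
  also have "\<dots> < \<infinity>"
    using emeasure_lborel_cball_finite[of 0 c] by simp
  finally show ?thesis .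
qed

text \<open>The left set is the preimage of the right one under \<open>boost a\<close>. In the
  substituted integral the Jacobian's numerator cancels the density
  \<open>1 / height (boost a x)\<close> and leaves \<open>1 / height x\<close>.\<close>

lemma emeasure_chart_volume_boost_wellorder:
  fixes a :: "real ^ 'm::{finite,wellorder}"
  shows "emeasure chart_volume {x. height a * height x - a \<bullet> x \<le> c} = emeasure (chart_volume :: (real ^ 'm::_) measure) {x. height x \<le> c}"
proof -
  let ?S = "{x. height x \<le> c} :: (real ^ 'm::_) set"
  let ?g = "\<lambda>x. indicator ?S x / height x"
  let ?J = "\<lambda>x. height (boost a x) / height x"
  have S: "?S \<in> sets borel" by measurable
  have cov: "(\<integral>\<^sup>+x. ?J x * ?g (boost a x) \<partial>lborel) = (\<integral>\<^sup>+x. ?g x \<partial>lborel)"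
  proof (rule nn_integral_change_of_variables[OF has_derivative_boost bij_boost])
    show "(\<integral>\<^sup>+x. ?g x \<partial>lborel) < \<infinity>"
      using emeasure_chart_volume_height_le_finite[of c] by (simp only: emeasure_chart_volume[OF S, symmetric])
    show "?J x = \<bar>det (matrix (\<lambda>h. h + ((a \<bullet> h) / (1 + height a) - (x \<bullet> h) / height x) *\<^sub>R a))\<bar>" for x
      unfolding det_boost by (simp add: less_imp_le)
  qed (auto simp: less_imp_le)
  have "?J x * ?g (boost a x) = indicator {x. height a * height x - a \<bullet> x \<le> c} x / height x" for x
    using height_pos[of "boost a x"] by (auto simp: height_boost split: split_indicator)
  then show ?thesis
    using cov by (subst (1 2) emeasure_chart_volume) auto
qed

text \<open>Relabelling coordinates by \<open>wo_vec\<close> preserves Lebesgue measure, inner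
  products and heights, hence also \<open>chart_volume\<close>, and so carries the result over from
  the well-ordered index type.\<close>

lemma emeasure_chart_volume_boost:
  fixes a :: "real ^ 'n"
  shows "emeasure chart_volume {x. height a * height x - a \<bullet> x \<le> c} = emeasure chart_volume {x :: real ^ 'n. height x \<le> c}"
proof -
  have h: "height (wo_vec x) = height x" for x :: "real ^ 'n"
    by (simp add: height_def)
  have *: "emeasure chart_volume (wo_vec -` A) = emeasure chart_volume A"
    if [measurable]: "A \<in> sets borel" for A :: "(real ^ 'n wo) set"
  proof -
    have "emeasure chart_volume A
        = (\<integral>\<^sup>+x. ennreal (indicator A x / height x) \<partial>distr lborel borel wo_vec)"
      by (simp add: distr_lborel_wo_vec emeasure_chart_volume)
    also have "\<dots> = (\<integral>\<^sup>+x. ennreal (indicator A (wo_vec x) / height (wo_vec x)) \<partial>lborel)"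
      by (rule nn_integral_distr) measurable
    also have "\<dots> = emeasure chart_volume (wo_vec -` A)"
      using measurable_sets[OF wo_vec_measurable that]
      by (subst emeasure_chart_volume) (auto simp: h indicator_vimage)
    finally show ?thesis by simp
  qed
  show ?thesis
    using emeasure_chart_volume_boost_wellorder[of "wo_vec a" c]
      *[of "{x. height (wo_vec a) * height x - wo_vec a \<bullet> x \<le> c}"] *[of "{x. height x \<le> c}"]
    by (simp add: h vimage_def)
qed

subsection \<open>Distribution of the distance\<close>

text \<open>The measures compared below have infinite total mass, so uniqueness of distribution
  functions of finite measures does not suffice. The half-lines are closed under intersection, and
  countably many of finite measure exhaust the line.\<close>

lemma measure_eqI_atMost:
  fixes M N :: "real measure"
  assumes sets: "sets M = sets borel" "sets N = sets borel"
    and eq: "\<And>x. emeasure M {..x} = emeasure N {..x}"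
    and fin: "\<And>x. emeasure M {..x} < \<infinity>"
  shows "M = N"
proof (rule measure_eqI_generator_eq[where E = "range atMost" and \<Omega> = UNIV and A = "\<lambda>i. {..real i}"])
  show "Int_stable (range (atMost :: real \<Rightarrow> _))"
    by (auto simp: Int_stable_def)
  have "sets borel = sigma_sets UNIV (range (atMost :: real \<Rightarrow> _))"
    by (subst borel_eq_atMost) simp
  then show "sets M = sigma_sets UNIV (range atMost)" "sets N = sigma_sets UNIV (range atMost)"
    using sets by auto
  show "(\<Union>i. {..real i}) = UNIV"
    by (auto intro: real_arch_simple)
  show "emeasure M {..real i} \<noteq> \<infinity>" for i
    using fin[of "real i"] by simp
qed (use eq in auto)

section \<open>Polar coordinates around the vertex\<close>

lemma arsinh_le_iff: "arsinh x \<le> y \<longleftrightarrow> x \<le> sinh (y :: real)"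
  using sinh_real_le_iff[of "arsinh x" y] by simp

lemma borel_measurable_arsinh [measurable]: "(arsinh :: real \<Rightarrow> real) \<in> borel_measurable borel"
  unfolding arsinh_real_def[abs_def] by measurable

lemma borel_measurable_sinh [measurable]: "(sinh :: real \<Rightarrow> real) \<in> borel_measurable borel"
  by (intro borel_measurable_continuous_onI continuous_intros)

lemma borel_measurable_cosh [measurable]: "(cosh :: real \<Rightarrow> real) \<in> borel_measurable borel"
  by (intro borel_measurable_continuous_onI continuous_intros)

lemma height_eq_cosh: "height x = cosh (arsinh (norm x))"
  by (simp add: height_def cosh_arsinh_real add.commute)

lemma height_le_cosh_iff:
  assumes "0 \<le> R"
  shows "height x \<le> cosh R \<longleftrightarrow> norm x \<le> sinh R"
proof -
  have "height x \<le> cosh R \<longleftrightarrow> (height x)\<^sup>2 \<le> (cosh R)\<^sup>2"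
    by (rule power_mono_iff[symmetric]) (auto simp: less_imp_le)
  also have "\<dots> \<longleftrightarrow> (norm x)\<^sup>2 \<le> (sinh R)\<^sup>2"
    by (simp add: height_sq cosh_square_eq)
  also have "\<dots> \<longleftrightarrow> norm x \<le> sinh R"
    using assms by (intro power_mono_iff) auto
  finally show ?thesis .
qed

text \<open>The condition \<open>arsinh (norm x) \<le> R\<close> describes the Euclidean ball of
  radius \<open>sinh R\<close>, and the density is the derivative of its volume in \<open>R\<close>.
  Here \<open>arsinh (norm x)\<close> is the hyperbolic distance to the vertex, although the measure
  is still Euclidean.\<close>

lemma distr_lborel_arsinh_norm:
  "distr lborel borel (\<lambda>x :: 'a::euclidean_space. arsinh (norm x))
    = density lborel (\<lambda>s. ennreal (real DIM('a) * unit_ball_vol (real DIM('a)) * sinh s ^ (DIM('a) - 1) * cosh s) * indicator {0..} s)"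
    (is "?M = density lborel ?f")
proof (rule measure_eqI_atMost)
  let ?n = "DIM('a)" and ?\<omega> = "unit_ball_vol (real DIM('a))"
  have M: "emeasure ?M {..R} = emeasure lborel {x :: 'a. norm x \<le> sinh R}" for R
    by (subst emeasure_distr) (auto simp: arsinh_le_iff vimage_def)
  have ball: "{x :: 'a. norm x \<le> sinh R} = cball 0 (sinh R)" for R
    by auto
  show "emeasure ?M {..R} < \<infinity>" for R
    unfolding M ball by (rule emeasure_lborel_cball_finite)
  show "emeasure ?M {..R} = emeasure (density lborel ?f) {..R}" for R
  proof (cases "0 \<le> R")
    case True
    have "emeasure (density lborel ?f) {..R}
        = (\<integral>\<^sup>+s. ennreal (real ?n * ?\<omega> * sinh s ^ (?n - 1) * cosh s) * indicator {0..R} s \<partial>lborel)"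
      by (subst emeasure_density) (auto intro!: nn_integral_cong split: split_indicator)
    also have "\<dots> = ?\<omega> * sinh R ^ ?n - ?\<omega> * sinh 0 ^ ?n"
    proof (rule nn_integral_FTC_Icc)
      show "((\<lambda>s. ?\<omega> * sinh s ^ ?n) has_real_derivative real ?n * ?\<omega> * sinh s ^ (?n - 1) * cosh s) (at s)" for s
        by (auto intro!: derivative_eq_intros)
      show "0 \<le> real ?n * ?\<omega> * sinh s ^ (?n - 1) * cosh s" if "s \<in> {0..R}" for s
        using that by (auto intro!: mult_nonneg_nonneg)
    qed (use True in auto)
    also have "\<dots> = emeasure ?M {..R}"
      unfolding M ball using True by (simp add: emeasure_cball)
    finally show ?thesis ..
  next
    case False
    \<comment> \<open>A negative \<open>R\<close> gives a negative radius.\<close>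
    then have "cball (0 :: 'a) (sinh R) = {}" by simp
    moreover have "emeasure (density lborel ?f) {..R} = 0"
      using False by (subst emeasure_density) (auto intro!: nn_integral_zero' split: split_indicator)
    ultimately show ?thesis unfolding M ball by simp
  qed
qed auto

text \<open>The volume density \<open>1 / height x\<close> equals \<open>1 / cosh s\<close> at
  radius \<open>s\<close> and cancels the factor \<open>cosh s\<close> from the
  substitution.\<close>

lemma emeasure_chart_volume_height_le:
  assumes "0 \<le> R"
  shows "emeasure chart_volume {x :: real ^ 'n. height x \<le> cosh R}
    = (\<integral>\<^sup>+s. ennreal (real CARD('n) * unit_ball_vol (real CARD('n)) * sinh s ^ (CARD('n) - 1)) * indicator {0..R} s \<partial>lborel)"
proof -
  let ?c = "real CARD('n) * unit_ball_vol (real CARD('n))"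
  have "emeasure chart_volume {x :: real ^ 'n. height x \<le> cosh R}
      = (\<integral>\<^sup>+x. ennreal (indicator {x. height x \<le> cosh R} x / height x) \<partial>(lborel :: (real ^ 'n) measure))"
    by (rule emeasure_chart_volume) measurable
  also have "\<dots> = (\<integral>\<^sup>+x. ennreal (indicator {..R} (arsinh (norm x)) / cosh (arsinh (norm x))) \<partial>(lborel :: (real ^ 'n) measure))"
  proof (rule nn_integral_cong)
    fix x :: "real ^ 'n"
    have "indicator {x. height x \<le> cosh R} x = (indicator {..R} (arsinh (norm x)) :: real)"
      using assms by (simp add: indicator_def height_le_cosh_iff arsinh_le_iff)
    then show "ennreal (indicator {x. height x \<le> cosh R} x / height x)
        = ennreal (indicator {..R} (arsinh (norm x)) / cosh (arsinh (norm x)))"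
      by (simp add: height_eq_cosh)
  qed
  also have "\<dots> = (\<integral>\<^sup>+s. ennreal (indicator {..R} s / cosh s) \<partial>distr lborel borel (\<lambda>x :: real ^ 'n. arsinh (norm x)))"
    by (rule nn_integral_distr[symmetric]) measurable
  also have "\<dots> = (\<integral>\<^sup>+s. (ennreal (?c * sinh s ^ (CARD('n) - 1) * cosh s) * indicator {0..} s) * ennreal (indicator {..R} s / cosh s) \<partial>lborel)"
    unfolding distr_lborel_arsinh_norm by (subst nn_integral_density) (auto simp: mult.assoc)
  also have "\<dots> = (\<integral>\<^sup>+s. ennreal (?c * sinh s ^ (CARD('n) - 1)) * indicator {0..R} s \<partial>lborel)"
    by (intro nn_integral_cong)
      (auto simp: ennreal_mult'[symmetric] split: split_indicator)
  finally show ?thesis .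
qed

section \<open>Hyperbolic distance and its image measure\<close>

lemma minus_minkowski_hyp_param:
  "- minkowski (hyp_param x) (hyp_param a) = height a * height x - a \<bullet> x"
  by (simp add: minkowski_def hyp_param_def height_def inner_vec_def mult.commute)

text \<open>Metric balls become sublevel sets of the boosted height. The condition
  \<open>0 \<le> R\<close> must be explicit because \<open>cosh\<close> is even and does not see the
  sign of the radius.\<close>

lemma hyp_dist_hyp_param_le_iff:
  "hyp_dist (hyp_param x) (hyp_param a) \<le> R \<longleftrightarrow> 0 \<le> R \<and> height a * height x - a \<bullet> x \<le> cosh R"
proof -
  let ?z = "height a * height x - a \<bullet> x"
  have z: "1 \<le> ?z" by (rule height_mult_minus_inner_ge_1)
  have d: "hyp_dist (hyp_param x) (hyp_param a) = arcosh ?z"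
    by (simp add: hyp_dist_def minus_minkowski_hyp_param)
  have "0 \<le> arcosh ?z" using z by simp
  moreover have "arcosh ?z \<le> R \<longleftrightarrow> ?z \<le> cosh R" if "0 \<le> R"
    using cosh_real_nonneg_le_iff[OF \<open>0 \<le> arcosh ?z\<close> that] z by simp
  ultimately show ?thesis unfolding d by force
qed

lemma hyp_dist_nonneg:
  assumes "y \<in> hyperbolic_space" "\<mu> \<in> hyperbolic_space"
  shows "0 \<le> hyp_dist y \<mu>"
proof -
  obtain x a where "y = hyp_param x" "\<mu> = hyp_param a"
    using assms bij_betw_hyp_param by (metis bij_betw_imp_surj_on imageE)
  \<comment> \<open>With the distance itself as radius, the equivalence yields its
    nonnegativity.\<close>
  then show ?thesis
    using hyp_dist_hyp_param_le_iff[of x a "hyp_dist y \<mu>"] by simp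
qed

lemma hyp_dist_measurable:
  fixes \<mu> :: "real \<times> (real ^ 'n)"
  shows "(\<lambda>y. hyp_dist y \<mu>) \<in> borel_measurable (borel :: (real \<times> (real ^ 'n)) measure)"
proof -
  have "(\<lambda>y. - minkowski y \<mu>) \<in> borel_measurable (borel :: (real \<times> (real ^ 'n)) measure)"
    unfolding minkowski_def by (intro borel_measurable_continuous_onI continuous_intros)
  moreover have "(arcosh :: real \<Rightarrow> real) \<in> borel_measurable borel"
    unfolding arcosh_def[abs_def] by measurable
  ultimately show ?thesis
    unfolding hyp_dist_def[abs_def] by (rule measurable_compose)
qed

lemma sets_hyp_volume [measurable_cong, simp]:
  "sets hyp_volume = sets (restrict_space borel hyperbolic_space)"
  by (simp add: hyp_volume_def)

lemma space_hyp_volume [simp]: "space hyp_volume = hyperbolic_space"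
  by (simp add: hyp_volume_def space_restrict_space)

lemma hyp_dist_measurable_hyp_volume [measurable]:
  "(\<lambda>y. hyp_dist y \<mu>) \<in> borel_measurable hyp_volume"
  by (subst measurable_cong_sets[OF sets_hyp_volume refl])
    (rule measurable_restrict_space1[OF hyp_dist_measurable])

text \<open>It suffices to compare balls. In coordinates, invariance under boosts moves the ball
  around \<open>\<mu>\<close> to the vertex, where its volume is known from polar
  coordinates.\<close>

lemma distr_hyp_volume_hyp_dist:
  fixes \<mu> :: "real \<times> (real ^ 'n)"
  assumes "\<mu> \<in> hyperbolic_space"
  shows "distr hyp_volume borel (\<lambda>y. hyp_dist y \<mu>)
    = density lborel (\<lambda>r. ennreal (real CARD('n) * unit_ball_vol (real CARD('n)) * sinh r ^ (CARD('n) - 1)) * indicator {0..} r)"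
    (is "?M = density lborel ?f")
proof (rule measure_eqI_atMost)
  obtain a where a: "\<mu> = hyp_param a"
    using assms bij_betw_hyp_param by (metis bij_betw_imp_surj_on imageE)
  have [measurable]: "hyp_param \<in> (chart_volume :: (real ^ 'n) measure) \<rightarrow>\<^sub>M restrict_space borel hyperbolic_space"
    using measurable_hyp_param by (simp cong: measurable_cong_sets)
  have M: "?M = distr chart_volume borel (\<lambda>x. hyp_dist (hyp_param x) \<mu>)"
    unfolding hyp_volume_eq
    by (subst distr_distr) (auto simp: o_def intro!: measurable_restrict_space1 hyp_dist_measurable)
  have [measurable]: "(\<lambda>x. hyp_dist (hyp_param x) \<mu>) \<in> borel_measurable (chart_volume :: (real ^ 'n) measure)"
    by (rule measurable_compose[OF _ measurable_restrict_space1[OF hyp_dist_measurable]]) measurable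
  have eq: "emeasure ?M {..R} = emeasure chart_volume {x :: real ^ 'n. 0 \<le> R \<and> height x \<le> cosh R}" for R
    unfolding M
    by (subst emeasure_distr, simp_all add: vimage_def a hyp_dist_hyp_param_le_iff, cases "0 \<le> R")
      (simp_all add: emeasure_chart_volume_boost)
  show "emeasure ?M {..R} < \<infinity>" for R
    unfolding eq using emeasure_chart_volume_height_le_finite[of "cosh R"] by (cases "0 \<le> R") auto
  show "emeasure ?M {..R} = emeasure (density lborel ?f) {..R}" for R
  proof (cases "0 \<le> R")
    case True
    then show ?thesis unfolding eq
      by (subst emeasure_density)
        (auto simp: emeasure_chart_volume_height_le intro!: nn_integral_cong split: split_indicator)
  next
    case False
    then have "emeasure (density lborel ?f) {..R} = 0"
      by (subst emeasure_density) (auto intro!: nn_integral_zero' split: split_indicator)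
    then show ?thesis unfolding eq using False by simp
  qed
qed auto

subsection \<open>The functions H\<close>

lemma erf_has_real_derivative:
  "(erf has_real_derivative 2 / sqrt pi * exp (- z\<^sup>2)) (at z)"
proof -
  \<comment> \<open>This bound keeps 0 and \<open>z\<close> inside a compact interval with
    \<open>z\<close> in the interior, so the derivative within the interval is the full
    derivative.\<close>
  let ?b = "\<bar>z\<bar> + 1"
  have "((\<lambda>u. LBINT t=ereal 0..ereal u. exp (- t\<^sup>2)) has_vector_derivative exp (- z\<^sup>2)) (at z within {- ?b..?b})"
    by (rule interval_integral_FTC2) (auto intro!: continuous_intros)
  moreover have "at z within {- ?b..?b} = at z"
    by (rule at_within_interior) (auto simp: interior_atLeastAtMost_real abs_if)
  ultimately have "((\<lambda>u. LBINT t=ereal 0..ereal u. exp (- t\<^sup>2)) has_real_derivative exp (- z\<^sup>2)) (at z)"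
    by (simp add: has_real_derivative_iff_has_vector_derivative)
  from DERIV_cmult[OF this, of "2 / sqrt pi"] show ?thesis
    unfolding erf_def[abs_def] .
qed

lemma erf_tendsto_1: "(erf \<longlongrightarrow> 1) at_top"
proof -
  let ?f = "\<lambda>t :: real. indicator {0..} t *\<^sub>R exp (- t\<^sup>2)"
  have f: "integrable lborel ?f" "integral\<^sup>L lborel ?f = sqrt pi / 2"
    using gaussian_moment_0 by (auto simp: has_bochner_integral_iff)
  have "((\<lambda>y. \<integral>t. indicator {..y} t *\<^sub>R ?f t \<partial>lborel) \<longlongrightarrow> sqrt pi / 2) at_top"
    using tendsto_integral_at_top[OF sets_lborel f(1)] unfolding f(2) .
  then have lim: "((\<lambda>y. 2 / sqrt pi * (\<integral>t. indicator {..y} t *\<^sub>R ?f t \<partial>lborel)) \<longlongrightarrow> 2 / sqrt pi * (sqrt pi / 2)) at_top"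
    by (rule tendsto_mult_left)
  have ev: "eventually (\<lambda>y. 2 / sqrt pi * (\<integral>t. indicator {..y} t *\<^sub>R ?f t \<partial>lborel) = erf y) at_top"
    using eventually_ge_at_top[of "0 :: real"]
  proof eventually_elim
    case (elim y)
    have "(LBINT t=ereal 0..ereal y. exp (- t\<^sup>2)) = (LBINT t:{0..y}. exp (- t\<^sup>2))"
      using elim by (rule interval_integral_Icc)
    also have "\<dots> = (\<integral>t. indicator {..y} t *\<^sub>R ?f t \<partial>lborel)"
      unfolding set_lebesgue_integral_def
      by (intro Bochner_Integration.integral_cong) (auto split: split_indicator)
    finally show ?case by (simp add: erf_def)
  qed
  from Lim_transform_eventually[OF lim ev] show ?thesis by simp
qed

section \<open>Powers of \<open>sinh\<close> and the antiderivative\<close>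

lemma sinh_power_binomial:
  fixes r :: real
  shows "sinh r ^ m = 1 / 2 ^ m * (\<Sum>j=0..m. real (m choose j) * (- 1) ^ j * exp ((real m - 2 * real j) * r))"
proof -
  \<comment> \<open>The summands are swapped so that \<open>j\<close> counts the factors
    \<open>- exp (- r)\<close>, which produces the exponent \<open>m - 2 * j\<close>.\<close>
  have "(exp r - exp (- r)) ^ m = (- exp (- r) + exp r) ^ m" by simp
  also have "\<dots> = (\<Sum>j\<le>m. of_nat (m choose j) * (- exp (- r)) ^ j * exp r ^ (m - j))"
    by (rule binomial_ring)
  also have "\<dots> = (\<Sum>j=0..m. real (m choose j) * (- 1) ^ j * exp ((real m - 2 * real j) * r))"
  proof (rule sum.cong)
    fix j assume "j \<in> {0..m}"
    then have "exp (- r) ^ j * exp r ^ (m - j) = exp ((real m - 2 * real j) * r)"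
      by (simp add: exp_of_nat_mult[symmetric] exp_add[symmetric] of_nat_diff algebra_simps)
    moreover have "(- exp (- r)) ^ j = (- 1) ^ j * exp (- r) ^ j"
      by (rule power_minus)
    ultimately show "of_nat (m choose j) * (- exp (- r)) ^ j * exp r ^ (m - j)
        = real (m choose j) * (- 1) ^ j * exp ((real m - 2 * real j) * r)"
      by (simp add: mult.assoc)
  qed auto
  finally show ?thesis
    by (simp add: sinh_field_def power_divide)
qed

text \<open>With \<open>k = m - 2 * j\<close>, completing the square gives \<open>k^2 * s / 2 - (R -
  s * k)^2 / (2 * s) = k * R - R^2 / (2 * s)\<close>. Each differentiated summand thus becomes an
  exponential times a common Gaussian, and the exponentials sum to the expansion of
  \<open>sinh R ^ m\<close>.\<close>

lemma H_fun_has_real_derivative: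
  assumes "0 < s"
  shows "(H_fun m s has_real_derivative sinh R ^ m * exp (- R\<^sup>2 / (2 * s))) (at R)"
proof -
  define q where "q = sqrt (2 * s)"
  define p where "p = sqrt (s / 2)"
  have pq: "0 < q" "q * q = 2 * s" "p * p = s / 2" "p * q = s"
    using assms by (auto simp: p_def q_def simp flip: real_sqrt_mult)
  have c: "sqrt (pi * s / 2) = sqrt pi * p"
    by (simp add: p_def flip: real_sqrt_mult)
  let ?k = "\<lambda>j. real m - 2 * real j"
  have "(H_fun m s has_real_derivative 1 / 2 ^ m * (sqrt pi * p) *
     (\<Sum>j=0..m. real (m choose j) * (-1) ^ j * exp ((?k j)\<^sup>2 * s / 2) *
        (2 / sqrt pi * exp (- (R / q - p * ?k j)\<^sup>2) * (1 / q)))) (at R)"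
    unfolding H_fun_def[abs_def] c q_def[symmetric] p_def[symmetric]
    by (intro DERIV_cmult DERIV_sum DERIV_chain2[OF erf_has_real_derivative])
      (use pq in \<open>auto intro!: derivative_eq_intros\<close>)
  also have "1 / 2 ^ m * (sqrt pi * p) *
     (\<Sum>j=0..m. real (m choose j) * (-1) ^ j * exp ((?k j)\<^sup>2 * s / 2) *
        (2 / sqrt pi * exp (- (R / q - p * ?k j)\<^sup>2) * (1 / q)))
     = 1 / 2 ^ m * (\<Sum>j=0..m. real (m choose j) * (- 1) ^ j * exp (?k j * R)) * exp (- R\<^sup>2 / (2 * s))"
  proof -
    have e: "exp ((?k j)\<^sup>2 * s / 2) * exp (- (R / q - p * ?k j)\<^sup>2) = exp (?k j * R) * exp (- R\<^sup>2 / (2 * s))" for j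
    proof -
      have "p = s / q" using pq by (simp add: field_simps)
      then have "(R / q - p * ?k j)\<^sup>2 = ((R - s * ?k j) / q)\<^sup>2" by (simp add: diff_divide_distrib)
      also have "\<dots> = (R - s * ?k j)\<^sup>2 / (2 * s)" using pq by (simp add: power_divide power2_eq_square)
      finally have sq: "(R / q - p * ?k j)\<^sup>2 = (R - s * ?k j)\<^sup>2 / (2 * s)" .
      have "(?k j)\<^sup>2 * s / 2 + - (R / q - p * ?k j)\<^sup>2 = ?k j * R + - R\<^sup>2 / (2 * s)"
        unfolding sq
        using assms by (simp add: field_simps power2_eq_square)
      then show ?thesis by (simp only: exp_add[symmetric])
    qed
    \<comment> \<open>Hence the prefactor of \<open>H_fun\<close>, the constant of the derivative of
      \<open>erf\<close> and the inner derivative \<open>1 / q\<close> cancel.\<close>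
    have "2 * p / q = 1"
    proof -
      have "2 * p * q = q * q" using pq by simp
      then have "2 * p = q" using pq by (simp only: mult_cancel_right) auto
      then show ?thesis using pq by simp
    qed
    then have f: "sqrt pi * p * (2 / sqrt pi * x * (1 / q)) = x" for x
      by (simp add: field_simps)
    have "1 / 2 ^ m * (sqrt pi * p) *
       (\<Sum>j=0..m. real (m choose j) * (-1) ^ j * exp ((?k j)\<^sup>2 * s / 2) *
          (2 / sqrt pi * exp (- (R / q - p * ?k j)\<^sup>2) * (1 / q)))
      = 1 / 2 ^ m * (\<Sum>j=0..m. real (m choose j) * (-1) ^ j *
          (exp ((?k j)\<^sup>2 * s / 2) * (sqrt pi * p * (2 / sqrt pi * exp (- (R / q - p * ?k j)\<^sup>2) * (1 / q)))))"
      by (simp add: sum_distrib_left mult_ac)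
    also have "\<dots> = 1 / 2 ^ m * (\<Sum>j=0..m. real (m choose j) * (-1) ^ j * (exp (?k j * R) * exp (- R\<^sup>2 / (2 * s))))"
      unfolding f e ..
    finally show ?thesis by (simp add: sum_distrib_right mult.assoc)
  qed
  also have "\<dots> = sinh R ^ m * exp (- R\<^sup>2 / (2 * s))"
    by (simp only: sinh_power_binomial)
  finally show ?thesis .
qed

lemma H_fun_tendsto:
  assumes "0 < s"
  shows "(H_fun m s \<longlongrightarrow> 1 / 2 ^ m * sqrt (pi * s / 2) *
     (\<Sum>j=0..m. real (m choose j) * (-1) ^ j * exp ((real m - 2 * real j)\<^sup>2 * s / 2))) at_top"
proof -
  have "filterlim (\<lambda>R. - c + R * (1 / sqrt (2 * s))) at_top at_top" for c
    using assms by (intro filterlim_tendsto_add_at_top filterlim_at_top_mult_tendsto_pos[where c = "1 / sqrt (2 * s)"]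
        tendsto_const filterlim_ident) auto
  then have "filterlim (\<lambda>R. R / sqrt (2 * s) - c) at_top at_top" for c
    by simp
  then have "((\<lambda>R. erf (R / sqrt (2 * s) - c)) \<longlongrightarrow> 1) at_top" for c
    by (rule filterlim_compose[OF erf_tendsto_1])
  then have "(H_fun m s \<longlongrightarrow> 1 / 2 ^ m * sqrt (pi * s / 2) *
     (\<Sum>j=0..m. real (m choose j) * (-1) ^ j * exp ((real m - 2 * real j)\<^sup>2 * s / 2) * 1)) at_top"
    unfolding H_fun_def[abs_def] by (intro tendsto_intros)
  then show ?thesis by simp
qed

lemma H_fun_tendsto_Lim:
  assumes "0 < s"
  shows "(H_fun m s \<longlongrightarrow> Lim at_top (H_fun m s)) at_top"
  using tendsto_Lim[OF _ H_fun_tendsto[OF assms]] H_fun_tendsto[OF assms, of m] by simp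

lemma H_fun_less:
  assumes "0 < s" "0 \<le> x" "x < y"
  shows "H_fun m s x < H_fun m s y"
proof (rule DERIV_pos_imp_increasing_open[OF \<open>x < y\<close>])
  \<comment> \<open>For positive \<open>m\<close> the derivative vanishes at 0, so positivity is
    available only in the open interval.\<close>
  show "\<exists>d. DERIV (H_fun m s) r :> d \<and> 0 < d" if "x < r" for r
    using H_fun_has_real_derivative[OF \<open>0 < s\<close>] \<open>0 \<le> x\<close> that
    by (intro exI[of _ "sinh r ^ m * exp (- r\<^sup>2 / (2 * s))"]) auto
  show "continuous_on {x..y} (H_fun m s)"
    by (meson H_fun_has_real_derivative[OF \<open>0 < s\<close>] DERIV_isCont continuous_at_imp_continuous_on)
qed

lemma H_fun_0_less_Lim:
  assumes "0 < s"
  shows "H_fun m s 0 < Lim at_top (H_fun m s)"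
proof -
  \<comment> \<open>Comparison with the intermediate point 1 keeps the inequality at 0 strict in the
    limit.\<close>
  have "eventually (\<lambda>R. H_fun m s 1 \<le> H_fun m s R) at_top"
    using H_fun_less[OF assms, of 1] by (auto simp: less_imp_le intro!: eventually_mono[OF eventually_gt_at_top[of 1]])
  then have "H_fun m s 1 \<le> Lim at_top (H_fun m s)"
    by (intro tendsto_lowerbound[OF H_fun_tendsto_Lim[OF assms]]) auto
  then show ?thesis
    using H_fun_less[OF assms, of 0 1 m] by simp
qed

subsection \<open>The normal distribution\<close>

definition sphere_area :: "nat \<Rightarrow> real" where
  "sphere_area n = 2 * pi powr (real n / 2) / Gamma (real n / 2)"

lemma sphere_area_eq:
  assumes "0 < n"
  shows "real n * unit_ball_vol (real n) = sphere_area n"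
proof -
  have *: "Gamma (real n / 2 + 1) = real n / 2 * Gamma (real n / 2)"
    using assms by (intro Gamma_plus1) (auto simp: nonpos_Ints_def)
  show ?thesis
    unfolding unit_ball_vol_def sphere_area_def * using assms by (simp add: field_simps)
qed

lemma sphere_area_pos: "0 < n \<Longrightarrow> 0 < sphere_area n"
  by (simp add: sphere_area_def Gamma_real_pos)

lemma nn_integral_hyp_volume_radial:
  fixes \<mu> :: "real \<times> (real ^ 'n)"
  assumes "\<mu> \<in> hyperbolic_space" and [measurable]: "F \<in> borel_measurable borel"
  shows "(\<integral>\<^sup>+y. F (hyp_dist y \<mu>) \<partial>hyp_volume)
    = (\<integral>\<^sup>+r. ennreal (sphere_area CARD('n) * sinh r ^ (CARD('n) - 1)) * indicator {0..} r * F r \<partial>lborel)"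
proof -
  have "(\<integral>\<^sup>+y. F (hyp_dist y \<mu>) \<partial>hyp_volume) = (\<integral>\<^sup>+r. F r \<partial>distr hyp_volume borel (\<lambda>y. hyp_dist y \<mu>))"
    by (rule nn_integral_distr[symmetric]) measurable
  then show ?thesis
    unfolding distr_hyp_volume_hyp_dist[OF assms(1)]
    by (simp add: nn_integral_density sphere_area_eq)
qed

text \<open>In polar coordinates the integrand is the derivative of
  \<open>sphere_area CARD('n) * H\<close>. The fundamental theorem for nonnegative integrands
  applies on the half-line and on \<open>{0..R}\<close>, and finiteness comes out with the
  value.\<close>

lemma nn_integral_hyp_volume_gaussian:
  fixes \<mu> :: "real \<times> (real ^ 'n)"
  assumes "\<mu> \<in> hyperbolic_space" "0 < s"
  defines "H \<equiv> H_fun (CARD('n) - 1) s"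
  shows "(\<integral>\<^sup>+y. ennreal (exp (- (hyp_dist y \<mu>)\<^sup>2 / (2 * s))) \<partial>hyp_volume)
      = ennreal (sphere_area CARD('n) * (Lim at_top H - H 0))"
    and "0 \<le> R \<Longrightarrow> (\<integral>\<^sup>+y. ennreal (exp (- (hyp_dist y \<mu>)\<^sup>2 / (2 * s))) * indicator {..R} (hyp_dist y \<mu>) \<partial>hyp_volume)
      = ennreal (sphere_area CARD('n) * (H R - H 0))"
proof -
  let ?m = "CARD('n) - 1" and ?A = "sphere_area CARD('n)"
  let ?h = "\<lambda>r. ?A * (sinh r ^ ?m * exp (- r\<^sup>2 / (2 * s)))"
  have A: "0 < ?A" by (simp add: sphere_area_pos)
  have der: "((\<lambda>r. ?A * H r) has_real_derivative ?h r) (at r)" for r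
    unfolding H_def by (intro DERIV_cmult H_fun_has_real_derivative assms)
  have h: "0 \<le> ?h r" if "0 \<le> r" for r
    using A that by simp
  have "(H \<longlongrightarrow> Lim at_top H) at_top"
    unfolding H_def by (rule H_fun_tendsto_Lim) fact
  then have lim: "((\<lambda>r. ?A * H r) \<longlongrightarrow> ?A * Lim at_top H) at_top"
    by (rule tendsto_mult_left)
  have "(\<integral>\<^sup>+y. ennreal (exp (- (hyp_dist y \<mu>)\<^sup>2 / (2 * s))) \<partial>hyp_volume)
      = (\<integral>\<^sup>+r. ennreal (?A * sinh r ^ ?m) * indicator {0..} r * ennreal (exp (- r\<^sup>2 / (2 * s))) \<partial>lborel)"
    by (rule nn_integral_hyp_volume_radial) (use assms in auto)
  also have "\<dots> = (\<integral>\<^sup>+r. ennreal (?h r) * indicator {0..} r \<partial>lborel)"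
    using A by (intro nn_integral_cong) (auto simp: ennreal_mult' mult.assoc split: split_indicator)
  also have "\<dots> = ?A * Lim at_top H - ?A * H 0"
    by (rule nn_integral_FTC_atLeast[OF _ der h lim]) auto
  finally show "(\<integral>\<^sup>+y. ennreal (exp (- (hyp_dist y \<mu>)\<^sup>2 / (2 * s))) \<partial>hyp_volume)
      = ennreal (?A * (Lim at_top H - H 0))"
    by (simp add: right_diff_distrib)
  assume "0 \<le> R"
  have "(\<integral>\<^sup>+y. ennreal (exp (- (hyp_dist y \<mu>)\<^sup>2 / (2 * s))) * indicator {..R} (hyp_dist y \<mu>) \<partial>hyp_volume)
      = (\<integral>\<^sup>+r. ennreal (?A * sinh r ^ ?m) * indicator {0..} r * (ennreal (exp (- r\<^sup>2 / (2 * s))) * indicator {..R} r) \<partial>lborel)"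
    by (rule nn_integral_hyp_volume_radial) (use assms in auto)
  also have "\<dots> = (\<integral>\<^sup>+r. ennreal (?h r) * indicator {0..R} r \<partial>lborel)"
    using A by (intro nn_integral_cong) (auto simp: ennreal_mult' mult.assoc split: split_indicator)
  also have "\<dots> = ?A * H R - ?A * H 0"
    by (rule nn_integral_FTC_Icc[OF _ der h]) (use \<open>0 \<le> R\<close> in auto)
  finally show "(\<integral>\<^sup>+y. ennreal (exp (- (hyp_dist y \<mu>)\<^sup>2 / (2 * s))) * indicator {..R} (hyp_dist y \<mu>) \<partial>hyp_volume)
      = ennreal (?A * (H R - H 0))"
    by (simp add: right_diff_distrib)
qed

theorem proposition5:
  fixes \<mu> :: "real \<times> (real ^ 'n)" and \<sigma>2 :: real
  assumes "\<mu> \<in> hyperbolic_space" and "\<sigma>2 > 0"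
  shows
    "let n = CARD('n);
         C = riem_normal_const hyp_volume hyp_dist \<mu> \<sigma>2;
         f = riem_normal_density hyp_volume hyp_dist \<mu> \<sigma>2;
         H = H_fun (n - 1) \<sigma>2
     in
     integrable hyp_volume (\<lambda>y. exp (- (hyp_dist y \<mu>)\<^sup>2 / (2 * \<sigma>2)))
     \<and> C = 2 * pi powr (real n / 2) / Gamma (real n / 2) * (Lim at_top H - H 0)
     \<and> (H \<longlongrightarrow> 1 / 2 ^ (n - 1) * sqrt (pi * \<sigma>2 / 2) *
          (\<Sum>j=0..n - 1. real ((n - 1) choose j) * (-1) ^ j *
             exp ((real n - 1 - 2 * real j)\<^sup>2 * \<sigma>2 / 2))) at_top
     \<and> prob_space (density hyp_volume (\<lambda>y. ennreal (f y)))
     \<and> (\<forall>y\<in>hyperbolic_space. f y = exp (- (hyp_dist y \<mu>)\<^sup>2 / (2 * \<sigma>2)) /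
          (2 * pi powr (real n / 2) / Gamma (real n / 2) * (Lim at_top H - H 0)))
     \<and> (\<forall>(P :: 'w measure) Y R. prob_space P
          \<longrightarrow> distributed P hyp_volume Y (\<lambda>y. ennreal (f y))
          \<longrightarrow> measure P {\<omega> \<in> space P. hyp_dist (Y \<omega>) \<mu> \<le> R} =
              (if R < 0 then 0 else (H R - H 0) / (Lim at_top H - H 0)))"
proof -
  define A where "A = sphere_area CARD('n)"
  define H where "H = H_fun (CARD('n) - 1) \<sigma>2"
  define L where "L = Lim at_top H - H 0"
  define w where "w y = exp (- (hyp_dist y \<mu>)\<^sup>2 / (2 * \<sigma>2))" for y
  have [measurable]: "w \<in> borel_measurable hyp_volume"
    unfolding w_def[abs_def] by measurable
  have w_nonneg: "0 \<le> w y" for y by (simp add: w_def)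
  have "0 < L"
    using H_fun_0_less_Lim[OF assms(2)] by (simp add: L_def H_def)
  have "0 < A" by (simp add: A_def sphere_area_pos)
  have total: "(\<integral>\<^sup>+y. ennreal (w y) \<partial>hyp_volume) = ennreal (A * L)"
    unfolding w_def A_def L_def H_def by (rule nn_integral_hyp_volume_gaussian(1)[OF assms])
  have part: "(\<integral>\<^sup>+y. ennreal (w y) * indicator {..R} (hyp_dist y \<mu>) \<partial>hyp_volume) = ennreal (A * (H R - H 0))"
    if "0 \<le> R" for R
    unfolding w_def A_def L_def H_def using that by (rule nn_integral_hyp_volume_gaussian(2)[OF assms])
  \<comment> \<open>Integrability ensures that the normalizing constant is a genuine integral and
    not the default value 0.\<close>
  have int: "integrable hyp_volume w"
    by (rule integrableI_nonneg) (simp_all add: total w_nonneg)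
  have C: "riem_normal_const hyp_volume hyp_dist \<mu> \<sigma>2 = A * L"
    unfolding riem_normal_const_def w_def[symmetric]
    by (subst integral_eq_nn_integral) (use \<open>0 < A\<close> \<open>0 < L\<close> in \<open>auto simp: total w_nonneg\<close>)
  have f: "riem_normal_density hyp_volume hyp_dist \<mu> \<sigma>2 = (\<lambda>y. 1 / (A * L) * w y)"
    unfolding riem_normal_density_def[abs_def] C w_def ..
  have f_ennreal: "ennreal (1 / (A * L) * w y) = ennreal (1 / (A * L)) * ennreal (w y)" for y
    using \<open>0 < A\<close> \<open>0 < L\<close> by (intro ennreal_mult) (auto simp: w_nonneg)
  have lim: "(H \<longlongrightarrow> 1 / 2 ^ (CARD('n) - 1) * sqrt (pi * \<sigma>2 / 2) *
          (\<Sum>j=0..CARD('n) - 1. real ((CARD('n) - 1) choose j) * (-1) ^ j *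
             exp ((real CARD('n) - 1 - 2 * real j)\<^sup>2 * \<sigma>2 / 2))) at_top"
    \<comment> \<open>The dimension is at least 1, so \<open>real (n - 1)\<close> equals
      \<open>real n - 1\<close>.\<close>
    using H_fun_tendsto[OF assms(2), of "CARD('n) - 1"] by (simp add: H_def of_nat_diff Suc_leI)
  have prob: "prob_space (density hyp_volume (\<lambda>y. ennreal (1 / (A * L) * w y)))"
  proof (rule prob_spaceI)
    have "emeasure (density hyp_volume (\<lambda>y. ennreal (1 / (A * L) * w y))) (space hyp_volume)
        = (\<integral>\<^sup>+y. ennreal (1 / (A * L) * w y) * indicator (space hyp_volume) y \<partial>hyp_volume)"
      by (intro emeasure_density sets.top) measurable
    also have "\<dots> = (\<integral>\<^sup>+y. ennreal (1 / (A * L)) * ennreal (w y) \<partial>hyp_volume)"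
      unfolding f_ennreal by (intro nn_integral_cong) simp
    also have "\<dots> = ennreal (1 / (A * L)) * ennreal (A * L)"
      by (simp add: nn_integral_cmult total)
    also have "\<dots> = 1"
      using \<open>0 < A\<close> \<open>0 < L\<close> by (subst ennreal_mult[symmetric]) auto
    finally show "emeasure (density hyp_volume (\<lambda>y. ennreal (1 / (A * L) * w y)))
        (space (density hyp_volume (\<lambda>y. ennreal (1 / (A * L) * w y)))) = 1"
      by simp
  qed
  have cdf: "measure P {\<omega> \<in> space P. hyp_dist (Y \<omega>) \<mu> \<le> R} = (if R < 0 then 0 else (H R - H 0) / L)"
    if "prob_space P" and Y: "distributed P hyp_volume Y (\<lambda>y. ennreal (1 / (A * L) * w y))"
    for P :: "'w measure" and Y R
  proof -
    \<comment> \<open>Having a density includes measurability of \<open>Y\<close> into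
      \<open>hyp_volume\<close>, whose space is the hyperboloid; nonnegativity of the distance is
      known only there.\<close>
    have space: "Y \<omega> \<in> hyperbolic_space" if "\<omega> \<in> space P" for \<omega>
      using measurable_space[OF distributed_measurable[OF Y] that] by simp
    show ?thesis
    proof (cases "R < 0")
      case True
      then have empty: "{\<omega> \<in> space P. hyp_dist (Y \<omega>) \<mu> \<le> R} = {}"
        using hyp_dist_nonneg[OF space assms(1)] by fastforce
      show ?thesis unfolding empty using True by simp
    next
      case False
      let ?B = "{y \<in> space hyp_volume. hyp_dist y \<mu> \<le> R}"
      have B: "?B \<in> sets hyp_volume" by measurable
      have "{\<omega> \<in> space P. hyp_dist (Y \<omega>) \<mu> \<le> R} = Y -` ?B \<inter> space P"
        using space by auto
      then have "emeasure P {\<omega> \<in> space P. hyp_dist (Y \<omega>) \<mu> \<le> R}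
          = (\<integral>\<^sup>+y. ennreal (1 / (A * L) * w y) * indicator ?B y \<partial>hyp_volume)"
        using distributed_emeasure[OF Y B] by simp
      also have "\<dots> = (\<integral>\<^sup>+y. ennreal (1 / (A * L)) * (ennreal (w y) * indicator {..R} (hyp_dist y \<mu>)) \<partial>hyp_volume)"
        unfolding f_ennreal by (intro nn_integral_cong) (auto split: split_indicator)
      also have "\<dots> = ennreal (1 / (A * L)) * ennreal (A * (H R - H 0))"
        using False by (simp add: nn_integral_cmult part)
      also have "\<dots> = ennreal ((H R - H 0) / L)"
        using \<open>0 < A\<close> \<open>0 < L\<close> by (subst ennreal_mult'[symmetric]) auto
      finally have "emeasure P {\<omega> \<in> space P. hyp_dist (Y \<omega>) \<mu> \<le> R} = ennreal ((H R - H 0) / L)" .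
      \<comment> \<open>Since \<open>ennreal\<close> sends negative numbers to 0, the sign is needed
        to recover the real value of \<open>measure\<close>.\<close>
      moreover have "0 \<le> (H R - H 0) / L"
      proof -
        have "H 0 \<le> H R"
          using H_fun_less[OF assms(2), of 0 R] False by (cases "R = 0") (auto simp: H_def less_imp_le)
        then show ?thesis using \<open>0 < L\<close> by simp
      qed
      ultimately show ?thesis
        using False by (simp add: measure_def)
    qed
  qed
  show ?thesis
    unfolding Let_def f C H_def[symmetric] L_def[symmetric] w_def[symmetric]
      sphere_area_def[symmetric] A_def[symmetric]
    using int lim prob cdf by auto
qed

end
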